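(* Let $A$ be a $B_1$-algebra. Then $Pr_s(A)$ and $MaxSpec(A)$ are spectral spaces in the sense of Hochster.
   Context: A (commutative) $B_1$-algebra is a commutative semiring $A$ with $0$ (absorbing for multiplication) and $1$, in which $1+1=1$ (so $x+x=x$ for all $x\in A$). An ideal of $A$ is a subset containing $0$, stable under addition and under multiplication by elements of $A$. An ideal $\mathcal P$ is prime if $\mathcal P\neq A$ and $ab\in\mathcal P$ implies $a\in\mathcal P$ or $b\in\mathcal P$. A congruence on $A$ is an equivalence relation compatible with addition and multiplication; the trivial congruence is the one under which any two elements are equivalent. Congruences are ordered by inclusion. For a congruence $\mathcal R$, $I(\mathcal R):=\{x\in A\mid x\,\mathcal R\,0\}$, an ideal. An ideal $J$ is saturated if $J=I(\mathcal R)$ for some congruence $\mathcal R$. A nontrivial congruence $\mathcal R$ is prime if $ab\,\mathcal R\,0$ implies $a\,\mathcal R\,0$ or $b\,\mathcal R\,0$. $Spec(A)$ is the set of prime congruences; $MaxSpec(A)\subseteq Spec(A)$ is the set of maximal elements among nontrivial congruences; $Pr(A)$ is the set of prime ideals and $Pr_s(A)$ the set of saturated prime ideals. The closed sets of $Pr(A)$ are the sets $W(S):=\{\mathcal P\in Pr(A)\mid S\subseteq\mathcal P\}$, $S\subseteq A$; the closed sets of $Spec(A)$ are the sets $V(S):=\{\mathcal R\in Spec(A)\mid S\subseteq I(\mathcal R)\}$, $S\subseteq A$. $Pr_s(A)$ and $MaxSpec(A)$ carry the induced topologies. A topological space is spectral (Hochster) if it is $T_0$ and quasi-compact, its quasi-compact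 open subsets form a basis closed under finite intersections, and every nonempty irreducible closed subset has a generic point. *)

theory Defs
  imports "HOL-Analysis.Analysis"
begin

text \<open>The library class comm_semiring_1 is not used because it demands 0 \<noteq> 1, which would exclude
  the zero algebra.\<close>

class b1_algebra = comm_semiring_0 + comm_monoid_mult +
  assumes one_plus_one: "1 + 1 = 1"
begin

lemma add_idem: "x + x = x"
  using distrib_left[of x 1 1] by (simp add: one_plus_one)

end

definition ideal_of :: "'a::b1_algebra set \<Rightarrow> bool" where
  "ideal_of J \<longleftrightarrow> 0 \<in> J \<and> (\<forall>x\<in>J. \<forall>y\<in>J. x + y \<in> J) \<and> (\<forall>a. \<forall>x\<in>J. a * x \<in> J)"

definition prime_ideal_of :: "'a::b1_algebra set \<Rightarrow> bool" where
  "prime_ideal_of P \<longleftrightarrow>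
     ideal_of P \<and> P \<noteq> UNIV \<and> (\<forall>a b. a * b \<in> P \<longrightarrow> a \<in> P \<or> b \<in> P)"

definition congruence :: "'a::b1_algebra rel \<Rightarrow> bool" where
  "congruence R \<longleftrightarrow> equiv UNIV R \<and>
     (\<forall>a b c d. (a, b) \<in> R \<longrightarrow> (c, d) \<in> R \<longrightarrow> (a + c, b + d) \<in> R \<and> (a * c, b * d) \<in> R)"

text \<open>The trivial congruence is the one identifying everything (not the equality relation).\<close>

definition nontrivial_congruence :: "'a::b1_algebra rel \<Rightarrow> bool" where
  "nontrivial_congruence R \<longleftrightarrow> congruence R \<and> R \<noteq> UNIV"

definition zero_ideal :: "'a::b1_algebra rel \<Rightarrow> 'a set" where
  "zero_ideal R = {x. (x, 0) \<in> R}"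

definition saturated :: "'a::b1_algebra set \<Rightarrow> bool" where
  "saturated J \<longleftrightarrow> (\<exists>R. congruence R \<and> J = zero_ideal R)"

definition prime_congruence :: "'a::b1_algebra rel \<Rightarrow> bool" where
  "prime_congruence R \<longleftrightarrow> nontrivial_congruence R \<and>
     (\<forall>a b. (a * b, 0) \<in> R \<longrightarrow> (a, 0) \<in> R \<or> (b, 0) \<in> R)"

definition Pr :: "'a::b1_algebra set set" where
  "Pr = {P. prime_ideal_of P}"

definition Pr_s :: "'a::b1_algebra set set" where
  "Pr_s = {P \<in> Pr. saturated P}"

definition Spec :: "'a::b1_algebra rel set" where
  "Spec = {R. prime_congruence R}"

definition MaxSpec :: "'a::b1_algebra rel set" where
  "MaxSpec = {R. nontrivial_congruence R \<and>
     (\<forall>R'. nontrivial_congruence R' \<longrightarrow> R \<subseteq> R' \<longrightarrow> R' = R)}"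

definition W :: "'a::b1_algebra set \<Rightarrow> 'a set set" where
  "W S = {P \<in> Pr. S \<subseteq> P}"

definition V :: "'a::b1_algebra set \<Rightarrow> 'a rel set" where
  "V S = {R \<in> Spec. S \<subseteq> zero_ideal R}"

definition Pr_topology :: "'a::b1_algebra set topology" where
  "Pr_topology = topology (\<lambda>U. U \<subseteq> Pr \<and> (\<exists>S. Pr - U = W S))"

definition Spec_topology :: "'a::b1_algebra rel topology" where
  "Spec_topology = topology (\<lambda>U. U \<subseteq> Spec \<and> (\<exists>S. Spec - U = V S))"

definition Pr_s_topology :: "'a::b1_algebra set topology" where
  "Pr_s_topology = subtopology Pr_topology Pr_s"

definition MaxSpec_topology :: "'a::b1_algebra rel topology" where
  "MaxSpec_topology = subtopology Spec_topology MaxSpec"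

definition irreducible_in :: "'a topology \<Rightarrow> 'a set \<Rightarrow> bool" where
  "irreducible_in X C \<longleftrightarrow> C \<subseteq> topspace X \<and> C \<noteq> {} \<and>
     (\<forall>Z1 Z2. closedin X Z1 \<longrightarrow> closedin X Z2 \<longrightarrow> C \<subseteq> Z1 \<union> Z2 \<longrightarrow> C \<subseteq> Z1 \<or> C \<subseteq> Z2)"

definition qc_open :: "'a topology \<Rightarrow> 'a set \<Rightarrow> bool" where
  "qc_open X U \<longleftrightarrow> openin X U \<and> compactin X U"

text \<open>Closure under the empty intersection is quasi-compactness of the whole space, so only binary
  intersections are listed.\<close>

definition spectral_space :: "'a topology \<Rightarrow> bool" where
  "spectral_space X \<longleftrightarrow>
     t0_space X \<and>
     compact_space X \<and>
     (\<forall>U. openin X U \<longrightarrow> (\<exists>B. (\<forall>K\<in>B. qc_open X K) \<and> U = \<Union>B)) \<and>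
     (\<forall>K L. qc_open X K \<longrightarrow> qc_open X L \<longrightarrow> qc_open X (K \<inter> L)) \<and>
     (\<forall>C. closedin X C \<longrightarrow> irreducible_in X C \<longrightarrow> (\<exists>x\<in>topspace X. X closure_of {x} = C))"

lemma closedin_topology_of_closed:
  assumes sub: "\<And>S. c S \<subseteq> X"
    and all: "c {} = X" and none: "c UNIV = {}"
    and un: "\<And>S T. \<exists>S'. c S \<union> c T = c S'"
    and inter: "\<And>\<S>. c (\<Union>\<S>) = X \<inter> (\<Inter>S\<in>\<S>. c S)"
  defines "X' \<equiv> topology (\<lambda>U. U \<subseteq> X \<and> (\<exists>S. X - U = c S))"
  shows "topspace X' = X" and "closedin X' C \<longleftrightarrow> (\<exists>S. C = c S)"
proof -
  have "istopology (\<lambda>U. U \<subseteq> X \<and> (\<exists>S. X - U = c S))"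
    unfolding istopology_def
  proof (intro conjI allI impI)
    fix U U' assume "U \<subseteq> X \<and> (\<exists>S. X - U = c S)" "U' \<subseteq> X \<and> (\<exists>S. X - U' = c S)"
    then show "U \<inter> U' \<subseteq> X" "\<exists>S. X - U \<inter> U' = c S"
      using un by (auto simp: Diff_Int)
  next
    fix \<K> assume K: "\<forall>K\<in>\<K>. K \<subseteq> X \<and> (\<exists>S. X - K = c S)"
    then show "\<Union>\<K> \<subseteq> X" by blast
    from K obtain f where f: "\<And>K. K \<in> \<K> \<Longrightarrow> X - K = c (f K)" by metis
    have "X - \<Union>\<K> = X \<inter> (\<Inter>S\<in>f ` \<K>. c S)"
      using f by auto
    then show "\<exists>S. X - \<Union>\<K> = c S" using inter by metis
  qed
  then have o: "openin X' U \<longleftrightarrow> U \<subseteq> X \<and> (\<exists>S. X - U = c S)" for U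
    by (simp add: X'_def)
  have "openin X' X" using o none by auto
  then show t: "topspace X' = X"
    by (metis o openin_subset openin_topspace subset_antisym)
  show "closedin X' C \<longleftrightarrow> (\<exists>S. C = c S)"
    unfolding closedin_def t o using sub by (metis Diff_subset double_diff subset_refl)
qed

lemma W_Un: "W S \<union> W T = W {s * t |s t. s \<in> S \<and> t \<in> T}"
proof (intro set_eqI iffI)
  fix P assume "P \<in> W S \<union> W T"
  then have P: "P \<in> Pr" "S \<subseteq> P \<or> T \<subseteq> P" by (auto simp: W_def)
  then have "\<forall>a. \<forall>x\<in>P. a * x \<in> P \<and> x * a \<in> P"
    by (auto simp: Pr_def prime_ideal_of_def ideal_of_def mult.commute)
  with P show "P \<in> W {s * t |s t. s \<in> S \<and> t \<in> T}" by (auto simp: W_def)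
next
  fix P assume "P \<in> W {s * t |s t. s \<in> S \<and> t \<in> T}"
  then have "P \<in> Pr" and "\<forall>s\<in>S. \<forall>t\<in>T. s * t \<in> P" by (auto simp: W_def)
  moreover from this have "\<forall>s\<in>S. \<forall>t\<in>T. s \<in> P \<or> t \<in> P"
    by (auto simp: Pr_def prime_ideal_of_def)
  ultimately show "P \<in> W S \<union> W T" by (auto simp: W_def)
qed

lemma ideal_of_zero_ideal:
  assumes "congruence R" shows "ideal_of (zero_ideal R)"
proof -
  have r: "(x, x) \<in> R" for x
    using assms by (simp add: congruence_def equiv_def refl_on_def)
  have add: "(a + c, b + d) \<in> R" and mult: "(a * c, b * d) \<in> R"
    if "(a, b) \<in> R" "(c, d) \<in> R" for a b c d
    using assms that by (auto simp: congruence_def)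
  show ?thesis
    using add[of _ 0 _ 0] mult[OF r, of _ 0] r by (auto simp: ideal_of_def zero_ideal_def)
qed

lemma one_notin_zero_ideal:
  assumes "nontrivial_congruence R" shows "1 \<notin> zero_ideal R"
proof
  assume "1 \<in> zero_ideal R"
  moreover have "ideal_of (zero_ideal R)"
    using assms ideal_of_zero_ideal nontrivial_congruence_def by blast
  ultimately have "x \<in> zero_ideal R" for x
    unfolding ideal_of_def by (metis mult.right_neutral)
  then have z: "(x, 0) \<in> R" for x by (simp add: zero_ideal_def)
  have "sym R" "trans R" using assms
    by (auto simp: nontrivial_congruence_def congruence_def equiv_def)
  then have "(x, y) \<in> R" for x y using z by (meson symD transD)
  then have "R = UNIV" by auto
  then show False using assms by (simp add: nontrivial_congruence_def)
qed

lemma Spec_zero_ideal_in_Pr: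
  assumes "R \<in> Spec" shows "zero_ideal R \<in> Pr"
proof -
  have "ideal_of (zero_ideal R)" "1 \<notin> zero_ideal R"
    using assms ideal_of_zero_ideal one_notin_zero_ideal
    by (auto simp: Spec_def prime_congruence_def nontrivial_congruence_def)
  with assms show ?thesis
    by (auto simp: Spec_def prime_congruence_def Pr_def prime_ideal_of_def zero_ideal_def)
qed

lemma V_eq: "V S = {R \<in> Spec. zero_ideal R \<in> W S}"
  using Spec_zero_ideal_in_Pr by (auto simp: V_def W_def)

lemma
  fixes C :: "'a::b1_algebra set set"
  shows topspace_Pr_topology: "topspace Pr_topology = (Pr :: 'a set set)"
    and closedin_Pr_topology: "closedin Pr_topology C \<longleftrightarrow> (\<exists>S. C = W S)"
proof -
  have 1: "W S \<subseteq> Pr" for S :: "'a set" by (auto simp: W_def)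
  have 2: "W {} = (Pr :: 'a set set)" by (auto simp: W_def)
  have 3: "W UNIV = ({} :: 'a set set)" by (auto simp: W_def Pr_def prime_ideal_of_def)
  have 4: "\<exists>S'. W S \<union> W T = W S'" for S T :: "'a set" using W_Un by blast
  have 5: "W (\<Union>\<S>) = Pr \<inter> (\<Inter>S\<in>\<S>. W S)" for \<S> :: "'a set set"
    by (auto simp: W_def)
  note * = closedin_topology_of_closed[of W, OF 1 2 3 4 5, folded Pr_topology_def]
  show "topspace (Pr_topology :: 'a set topology) = Pr"
    "closedin Pr_topology C \<longleftrightarrow> (\<exists>S. C = W S)" by (rule *)+
qed

lemma
  fixes C :: "'a::b1_algebra rel set"
  shows topspace_Spec_topology: "topspace Spec_topology = (Spec :: 'a rel set)"
    and closedin_Spec_topology: "closedin Spec_topology C \<longleftrightarrow> (\<exists>S. C = V S)"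
proof -
  have 1: "V S \<subseteq> Spec" for S :: "'a set" by (auto simp: V_def)
  have 2: "V {} = (Spec :: 'a rel set)" by (auto simp: V_def)
  have 3: "V UNIV = ({} :: 'a rel set)"
    by (auto simp: V_eq W_def Pr_def prime_ideal_of_def)
  have 4: "\<exists>S'. V S \<union> V T = V S'" for S T :: "'a set"
  proof -
    have "V S \<union> V T = {R \<in> Spec. zero_ideal R \<in> W S \<union> W T}" by (auto simp: V_eq)
    then show ?thesis unfolding W_Un V_eq[symmetric] by blast
  qed
  have 5: "V (\<Union>\<S>) = Spec \<inter> (\<Inter>S\<in>\<S>. V S)" for \<S> :: "'a set set"
    by (auto simp: V_def)
  note * = closedin_topology_of_closed[of V, OF 1 2 3 4 5, folded Spec_topology_def]
  show "topspace (Spec_topology :: 'a rel topology) = Spec"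
    "closedin Spec_topology C \<longleftrightarrow> (\<exists>S. C = V S)" by (rule *)+
qed

lemma MaxSpec_subset_Spec: "MaxSpec \<subseteq> Spec"
proof
  fix R :: "'a rel" assume R: "R \<in> MaxSpec"
  then have nt: "nontrivial_congruence R"
    and max: "\<And>R'. nontrivial_congruence R' \<Longrightarrow> R \<subseteq> R' \<Longrightarrow> R' = R"
    by (auto simp: MaxSpec_def)
  then have eq: "equiv UNIV R" by (simp add: nontrivial_congruence_def congruence_def)
  have r: "(x, x) \<in> R" for x using eq by (simp add: equiv_def refl_on_def)
  have s: "(x, y) \<in> R \<Longrightarrow> (y, x) \<in> R" for x y using eq by (auto simp: equiv_def dest: symD)
  have t: "(x, y) \<in> R \<Longrightarrow> (y, z) \<in> R \<Longrightarrow> (x, z) \<in> R" for x y z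
    using eq by (meson equiv_def transD)
  have add: "(a + c, b + d) \<in> R" and mult: "(a * c, b * d) \<in> R"
    if "(a, b) \<in> R" "(c, d) \<in> R" for a b c d
    using nt that by (auto simp: nontrivial_congruence_def congruence_def)
  have "(b, 0) \<in> R" if ab: "(a * b, 0) \<in> R" and a: "(a, 0) \<notin> R" for a b
  proof -
    define Q where "Q = {(x, y). (a * x, a * y) \<in> R}"
    have "refl Q" using r by (auto simp: Q_def refl_on_def)
    moreover have "sym Q" using s by (auto simp: Q_def sym_def)
    moreover have "trans Q" using t unfolding Q_def trans_def by blast
    moreover have "(x + x', y + y') \<in> Q" if "(x, y) \<in> Q" "(x', y') \<in> Q" for x y x' y'
      using that add by (auto simp: Q_def distrib_left)
    moreover have "(x * x', y * y') \<in> Q" if "(x, y) \<in> Q" "(x', y') \<in> Q" for x y x' y'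
    proof -
      have "(a * x * x', a * y * x') \<in> R" "(a * x' * y, a * y' * y) \<in> R"
        using that mult[OF _ r] by (auto simp: Q_def)
      then show ?thesis using t by (auto simp: Q_def ac_simps)
    qed
    ultimately have "congruence Q" by (auto simp: congruence_def equiv_def)
    moreover have "(1, 0) \<notin> Q" using a by (simp add: Q_def)
    ultimately have "nontrivial_congruence Q" by (auto simp: nontrivial_congruence_def)
    moreover have "R \<subseteq> Q" using mult[OF r] by (auto simp: Q_def)
    ultimately have "Q = R" using max by blast
    moreover have "(b, 0) \<in> Q" using ab by (simp add: Q_def)
    ultimately show ?thesis by simp
  qed
  with nt show "R \<in> Spec" by (auto simp: Spec_def prime_congruence_def)
qed

lemma topspace_Pr_s_topology: "topspace Pr_s_topology = Pr_s"
  by (auto simp: Pr_s_topology_def topspace_Pr_topology Pr_s_def)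

lemma topspace_MaxSpec_topology: "topspace MaxSpec_topology = MaxSpec"
  using MaxSpec_subset_Spec by (auto simp: MaxSpec_topology_def topspace_Spec_topology)

end

theory Submission
  imports Defs
begin

text \<open>A saturated prime ideal is the kernel of a homomorphism onto the two-element algebra, so that
  membership of \<open>Pr_s\<close> is a propositional condition on subsets of \<open>A\<close>. The compactness argument of
  propositional logic then makes the basic open sets \<open>{P. f \<notin> P}\<close> quasi-compact, and the
  intersection of the members of an irreducible closed set is its generic point. A maximal
  congruence is likewise the kernel congruence of a homomorphism onto the two-element algebra and is
  determined by its zero ideal, so \<open>MaxSpec\<close> and \<open>Pr_s\<close> are homeomorphic.\<close>

section \<open>Homomorphisms onto the two-element algebra and saturated primes\<close>

text \<open>The kernel relation of the map to the two-element algebra that sends \<open>P\<close> to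
  0 and its complement to 1. It makes sense for every set; compatibility with the operations is a
  separate question.\<close>

definition two_class_congruence :: "'a set \<Rightarrow> 'a rel" where
  "two_class_congruence P = {(x, y). x \<in> P \<longleftrightarrow> y \<in> P}"

text \<open>The two assumptions say that the map to the two-element algebra is additive and
  multiplicative: a sum vanishes iff both terms do, a product iff some factor does. So the class of
  a sum or a product depends only on the classes of the operands.\<close>

lemma congruence_two_class_congruence:
  assumes "\<And>x y. x + y \<in> P \<longleftrightarrow> x \<in> P \<and> y \<in> P" "\<And>x y. x * y \<in> P \<longleftrightarrow> x \<in> P \<or> y \<in> P"
  shows "congruence (two_class_congruence P)"
  using assms
  by (auto simp: congruence_def two_class_congruence_def equiv_def refl_on_def sym_def trans_def)

lemma zero_ideal_two_class_congruence:
  "0 \<in> P \<Longrightarrow> zero_ideal (two_class_congruence P) = P"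
  by (auto simp: zero_ideal_def two_class_congruence_def)

lemma congruenceD:
  assumes "congruence R"
  shows "(x, x) \<in> R" "(x, y) \<in> R \<Longrightarrow> (y, x) \<in> R" "(x, y) \<in> R \<Longrightarrow> (y, z) \<in> R \<Longrightarrow> (x, z) \<in> R"
    "(a, b) \<in> R \<Longrightarrow> (c, d) \<in> R \<Longrightarrow> (a + c, b + d) \<in> R"
  using assms unfolding congruence_def equiv_def
  by (auto simp: refl_on_def dest: symD transD)

text \<open>Adding \<open>x\<close> to the relation \<open>x + y\<close> ~ 0 gives
  \<open>x + (x + y)\<close> ~ \<open>x\<close>. By idempotence the left side is
  \<open>x + y\<close>, so \<open>x\<close> ~ \<open>x + y\<close> ~ 0.\<close>

lemma saturated_add_cancel:
  assumes "saturated J" "x + y \<in> J" shows "x \<in> J"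
proof -
  obtain R where R: "congruence R" "J = zero_ideal R"
    using assms(1) by (auto simp: saturated_def)
  have xy: "(x + y, 0) \<in> R" using assms(2) R by (simp add: zero_ideal_def)
  have "x + (x + y) = x + y" by (simp add: add_idem flip: add.assoc)
  then have "(x + y, x) \<in> R"
    using congruenceD(4)[OF R(1) congruenceD(1)[OF R(1)] xy, of x] by simp
  then have "(x, x + y) \<in> R" by (rule congruenceD(2)[OF R(1)])
  then have "(x, 0) \<in> R" using xy by (rule congruenceD(3)[OF R(1)])
  then show ?thesis by (simp add: R(2) zero_ideal_def)
qed

text \<open>Saturation enters only through cancellation in sums; conversely, the two-class
  congruence witnesses it. In this form each condition concerns finitely many elements, which is
  what the compactness argument needs.\<close>

lemma Pr_s_iff:
  "P \<in> Pr_s \<longleftrightarrow> 0 \<in> P \<and> 1 \<notin> P \<and> (\<forall>x y. x + y \<in> P \<longleftrightarrow> x \<in> P \<and> y \<in> P) \<and>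
     (\<forall>x y. x * y \<in> P \<longleftrightarrow> x \<in> P \<or> y \<in> P)"
proof
  assume "P \<in> Pr_s"
  then have P: "ideal_of P" "P \<noteq> UNIV" "saturated P" "\<And>a b. a * b \<in> P \<Longrightarrow> a \<in> P \<or> b \<in> P"
    by (auto simp: Pr_s_def Pr_def prime_ideal_of_def)
  have "1 \<notin> P"
    using P(1,2) unfolding ideal_of_def by (metis UNIV_eq_I mult.right_neutral)
  moreover have "x + y \<in> P \<longleftrightarrow> x \<in> P \<and> y \<in> P" for x y
    using P(1) saturated_add_cancel[OF P(3)] unfolding ideal_of_def by (metis add.commute)
  moreover have "x * y \<in> P \<longleftrightarrow> x \<in> P \<or> y \<in> P" for x y
  proof
    show "x * y \<in> P \<Longrightarrow> x \<in> P \<or> y \<in> P" by (rule P(4))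
    have "a * z \<in> P" if "z \<in> P" for a z using P(1) that by (simp add: ideal_of_def)
    from this[of x y] this[of y x] show "x \<in> P \<or> y \<in> P \<Longrightarrow> x * y \<in> P"
      by (auto simp: mult.commute)
  qed
  ultimately show "0 \<in> P \<and> 1 \<notin> P \<and> (\<forall>x y. x + y \<in> P \<longleftrightarrow> x \<in> P \<and> y \<in> P) \<and>
      (\<forall>x y. x * y \<in> P \<longleftrightarrow> x \<in> P \<or> y \<in> P)"
    using P(1) by (auto simp: ideal_of_def)
next
  assume P: "0 \<in> P \<and> 1 \<notin> P \<and> (\<forall>x y. x + y \<in> P \<longleftrightarrow> x \<in> P \<and> y \<in> P) \<and>
     (\<forall>x y. x * y \<in> P \<longleftrightarrow> x \<in> P \<or> y \<in> P)"
  then have "saturated P"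
    unfolding saturated_def
    by (intro exI[of _ "two_class_congruence P"] conjI congruence_two_class_congruence)
      (auto simp: zero_ideal_two_class_congruence)
  with P show "P \<in> Pr_s"
    by (auto simp: Pr_s_def Pr_def prime_ideal_of_def ideal_of_def)
qed

section \<open>Compactness for saturated primes\<close>

text \<open>Zorn's lemma enlarges \<open>S\<close> to a maximal set all of whose finite subsets lie
  in a saturated prime avoiding \<open>f\<close>. Maximality makes this set itself a saturated
  prime.\<close>

lemma Pr_s_compactness:
  fixes f :: "'a::b1_algebra"
  assumes fin: "\<And>F. finite F \<Longrightarrow> F \<subseteq> S \<Longrightarrow> \<exists>P\<in>Pr_s. F \<subseteq> P \<and> f \<notin> P"
  shows "\<exists>P\<in>Pr_s. S \<subseteq> P \<and> f \<notin> P"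
proof -
  define cons where "cons T \<longleftrightarrow> (\<forall>F. finite F \<longrightarrow> F \<subseteq> T \<longrightarrow> (\<exists>P\<in>Pr_s. F \<subseteq> P \<and> f \<notin> P))"
    for T :: "'a set"
  have consD: "\<exists>P\<in>Pr_s. F \<subseteq> P \<and> f \<notin> P" if "cons T" "finite F" "F \<subseteq> T" for F T
    using that by (auto simp: cons_def)
  have "\<exists>M\<in>{T. S \<subseteq> T \<and> cons T}. \<forall>X\<in>{T. S \<subseteq> T \<and> cons T}. M \<subseteq> X \<longrightarrow> X = M"
  proof (rule subset_Zorn_nonempty)
    show "{T. S \<subseteq> T \<and> cons T} \<noteq> {}" using fin by (auto simp: cons_def)
  next
    \<comment> \<open>A finite subset of the union of a nonempty chain already lies in one member of
      the chain, so consistency passes to the union.\<close>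
    fix \<C> assume \<C>: "\<C> \<noteq> {}" "subset.chain {T. S \<subseteq> T \<and> cons T} \<C>"
    have "\<exists>P\<in>Pr_s. F \<subseteq> P \<and> f \<notin> P" if F: "finite F" "F \<subseteq> \<Union>\<C>" for F
    proof -
      obtain T where "T \<in> \<C>" "F \<subseteq> T"
        using finite_subset_Union_chain[OF F \<C>] by blast
      then show ?thesis using \<C>(2) F(1) consD by (auto simp: subset.chain_def)
    qed
    then show "\<Union>\<C> \<in> {T. S \<subseteq> T \<and> cons T}"
      using \<C> unfolding cons_def subset.chain_def by blast
  qed
  then obtain M where M: "S \<subseteq> M" "cons M" and max: "\<And>T. M \<subseteq> T \<Longrightarrow> cons T \<Longrightarrow> T = M"
    by auto
  \<comment> \<open>By maximality, adding an element \<open>a\<close> outside \<open>M\<close>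
    destroys consistency, so a finite part of \<open>M\<close> already excludes \<open>a\<close>
    from every prime that avoids \<open>f\<close>.\<close>
  have outside: "\<exists>F. finite F \<and> F \<subseteq> M \<and> (\<forall>P\<in>Pr_s. F \<subseteq> P \<longrightarrow> a \<in> P \<longrightarrow> f \<in> P)" if "a \<notin> M" for a
  proof -
    have "\<not> cons (insert a M)" using max[of "insert a M"] that by auto
    then obtain F where F: "finite F" "F \<subseteq> insert a M" "\<And>P. P \<in> Pr_s \<Longrightarrow> F \<subseteq> P \<Longrightarrow> f \<in> P"
      by (auto simp: cons_def)
    have "finite (F - {a})" "F - {a} \<subseteq> M" using F by auto
    moreover have "f \<in> P" if "P \<in> Pr_s" "F - {a} \<subseteq> P" "a \<in> P" for P
      using that F(3)[of P] by blast
    ultimately show ?thesis by blast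
  qed
  \<comment> \<open>\<open>M\<close> is closed under finite entailment: if \<open>a\<close> were
    outside, a prime avoiding \<open>f\<close> and containing both \<open>F\<close> and the finite
    set \<open>G\<close> that excludes \<open>a\<close> would contain \<open>a\<close> because of
    \<open>F\<close>.\<close>
  have entailed: "a \<in> M" if F: "finite F" "F \<subseteq> M" "\<And>P. P \<in> Pr_s \<Longrightarrow> F \<subseteq> P \<Longrightarrow> a \<in> P" for a F
  proof (rule ccontr)
    assume "a \<notin> M"
    then obtain G where G: "finite G" "G \<subseteq> M" "\<forall>P\<in>Pr_s. G \<subseteq> P \<longrightarrow> a \<in> P \<longrightarrow> f \<in> P"
      using outside by blast
    obtain P where "P \<in> Pr_s" "F \<union> G \<subseteq> P" "f \<notin> P"
      using consD[OF M(2), of "F \<union> G"] F(1,2) G(1,2) by auto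
    then show False using G(3) F(3) by blast
  qed
  have f: "f \<notin> M" using consD[OF M(2), of "{f}"] by auto
  have "0 \<in> M" by (rule entailed[of "{}"]) (auto simp: Pr_s_iff)
  moreover have "1 \<notin> M" using consD[OF M(2), of "{1}"] by (auto simp: Pr_s_iff)
  moreover have "x \<in> M \<and> y \<in> M" if "x + y \<in> M" for x y
    using entailed[of "{x + y}"] that by (auto simp: Pr_s_iff)
  moreover have "x + y \<in> M" if "x \<in> M" "y \<in> M" for x y
    by (rule entailed[of "{x, y}"]) (use that in \<open>auto simp: Pr_s_iff\<close>)
  moreover have "x * y \<in> M" if "x \<in> M \<or> y \<in> M" for x y
    using that entailed[of "{x}" "x * y"] entailed[of "{y}" "x * y"] by (auto simp: Pr_s_iff)
  \<comment> \<open>Primality is a disjunction and hence no instance of \<open>entailed\<close>.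
    Instead, the finite sets excluding \<open>x\<close> and \<open>y\<close> are joined with
    \<open>x * y\<close>: a prime containing all of them and avoiding \<open>f\<close> would contain
    one of the factors.\<close>
  moreover have "x \<in> M \<or> y \<in> M" if xy: "x * y \<in> M" for x y
  proof (rule ccontr)
    assume "\<not> (x \<in> M \<or> y \<in> M)"
    then obtain F G where
      F: "finite F" "F \<subseteq> M" "\<forall>P\<in>Pr_s. F \<subseteq> P \<longrightarrow> x \<in> P \<longrightarrow> f \<in> P" and
      G: "finite G" "G \<subseteq> M" "\<forall>P\<in>Pr_s. G \<subseteq> P \<longrightarrow> y \<in> P \<longrightarrow> f \<in> P"
      using outside by meson
    obtain P where P: "P \<in> Pr_s" "insert (x * y) (F \<union> G) \<subseteq> P" "f \<notin> P"
      using consD[OF M(2), of "insert (x * y) (F \<union> G)"] F(1,2) G(1,2) xy by auto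
    then have "x \<in> P \<or> y \<in> P" by (auto simp: Pr_s_iff)
    with P F(3) G(3) show False by blast
  qed
  ultimately have "M \<in> Pr_s" unfolding Pr_s_iff by blast
  with M(1) f show ?thesis by blast
qed

section \<open>A criterion for spectrality\<close>

text \<open>The hypotheses say that \<open>X\<close> is \<open>Pr_s\<close> with its topology
  transported along \<open>I\<close>. Stating the result for an abstract \<open>X\<close> serves
  both spaces, with \<open>I\<close> the identity or \<open>zero_ideal\<close>.\<close>

lemma spectral_space_if_bij_betw_Pr_s:
  fixes X :: "'p topology" and I :: "'p \<Rightarrow> 'a::b1_algebra set"
  assumes bij: "bij_betw I (topspace X) Pr_s"
    and closed: "\<And>C. closedin X C \<longleftrightarrow> (\<exists>S. C = {x \<in> topspace X. S \<subseteq> I x})"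
  shows "spectral_space X"
proof -
  define D where "D f = {x \<in> topspace X. f \<notin> I x}" for f
  have I: "0 \<in> I x" "1 \<notin> I x" "a + b \<in> I x \<longleftrightarrow> a \<in> I x \<and> b \<in> I x"
    "a * b \<in> I x \<longleftrightarrow> a \<in> I x \<or> b \<in> I x" if "x \<in> topspace X" for x a b
    using bij_betwE[OF bij] that by (auto simp: Pr_s_iff)
  have open_D: "openin X (D f)" for f
  proof -
    have "topspace X - D f = {x \<in> topspace X. {f} \<subseteq> I x}" by (auto simp: D_def)
    then have "closedin X (topspace X - D f)" using closed by blast
    then show ?thesis by (auto simp: openin_closedin_eq D_def)
  qed
  have open_basis: "\<exists>S. U = (\<Union>s\<in>S. D s)" if U: "openin X U" for U
  proof -
    obtain S where "topspace X - U = {x \<in> topspace X. S \<subseteq> I x}"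
      using closed U by (meson openin_closedin_eq)
    then have "U = (\<Union>s\<in>S. D s)" using openin_subset[OF U] by (auto simp: D_def)
    then show ?thesis by blast
  qed
  have D_mult: "D (f * g) = D f \<inter> D g" for f g
    using I(4) by (auto simp: D_def)
  have compact_D: "compactin X (D f)" for f
    unfolding compactin_def
  proof (intro conjI allI impI)
    show "D f \<subseteq> topspace X" by (auto simp: D_def)
  next
    fix \<U> assume \<U>: "Ball \<U> (openin X) \<and> D f \<subseteq> \<Union>\<U>"
    define S where "S = {s. \<exists>U\<in>\<U>. D s \<subseteq> U}"
    have "D f \<subseteq> (\<Union>s\<in>S. D s)"
    proof
      fix x assume "x \<in> D f"
      then obtain U where U: "U \<in> \<U>" "x \<in> U" using \<U> by blast
      then obtain T where T: "U = (\<Union>s\<in>T. D s)" using \<U> open_basis[of U] by auto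
      then obtain s where s: "s \<in> T" "x \<in> D s" using U by blast
      then have "D s \<subseteq> U" using T by blast
      then show "x \<in> (\<Union>s\<in>S. D s)" using U(1) s(2) by (auto simp: S_def)
    qed
    \<comment> \<open>A saturated prime containing \<open>S\<close> and avoiding \<open>f\<close>
      would be \<open>I x\<close> for a point \<open>x\<close> of \<open>D f\<close> outside all
      \<open>D s\<close> with \<open>s\<close> in \<open>S\<close>. Quasi-compactness of
      \<open>D f\<close> is thus the contrapositive of \<open>Pr_s_compactness\<close>.\<close>
    then have "\<not> (\<exists>P\<in>Pr_s. S \<subseteq> P \<and> f \<notin> P)"
      unfolding bij_betw_imp_surj_on[OF bij, symmetric] by (auto simp: D_def)
    then obtain F where F: "finite F" "F \<subseteq> S" "\<not> (\<exists>P\<in>Pr_s. F \<subseteq> P \<and> f \<notin> P)"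
      using Pr_s_compactness[of S f] by blast
    have "D f \<subseteq> (\<Union>s\<in>F. D s)"
      using F(3) unfolding bij_betw_imp_surj_on[OF bij, symmetric] by (auto simp: D_def)
    moreover have "\<forall>s\<in>F. \<exists>U. U \<in> \<U> \<and> D s \<subseteq> U" using F(2) by (auto simp: S_def)
    then obtain u where "\<forall>s\<in>F. u s \<in> \<U> \<and> D s \<subseteq> u s" by (rule bchoice[THEN exE])
    ultimately have "finite (u ` F)" "u ` F \<subseteq> \<U>" "D f \<subseteq> \<Union>(u ` F)"
      using F(1) by blast+
    then show "\<exists>\<F>. finite \<F> \<and> \<F> \<subseteq> \<U> \<and> D f \<subseteq> \<Union>\<F>" by blast
  qed
  have D_1: "D 1 = topspace X" using I(2) by (auto simp: D_def)
  \<comment> \<open>Every quasi-compact open set is a finite union of basic ones, so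
    \<open>D_mult\<close> also makes an intersection of two such sets a finite union of basic
    ones.\<close>
  have qc_finite: "\<exists>F. finite F \<and> K = (\<Union>f\<in>F. D f)" if K: "qc_open X K" for K
  proof -
    obtain S where S: "K = (\<Union>s\<in>S. D s)" using open_basis[of K] K by (auto simp: qc_open_def)
    have "compactin X K" using K by (simp add: qc_open_def)
    then obtain \<F> where \<F>: "finite \<F>" "\<F> \<subseteq> D ` S" "K \<subseteq> \<Union>\<F>"
      using open_D S unfolding compactin_def by (auto dest!: spec[of _ "D ` S"])
    then obtain F where "F \<subseteq> S" "finite F" "\<F> = D ` F" by (meson finite_subset_image)
    with \<F> S show ?thesis by blast
  qed
  have "t0_space X"
    unfolding t0_space_def
  proof (intro ballI impI)
    fix x y assume xy: "x \<in> topspace X" "y \<in> topspace X" "x \<noteq> y"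
    then have "I x \<noteq> I y" using bij by (auto simp: bij_betw_def inj_on_def)
    then obtain a where "a \<in> I x \<longleftrightarrow> a \<notin> I y" by blast
    then show "\<exists>U. openin X U \<and> (x \<notin> U) = (y \<in> U)"
      using xy open_D[of a] by (intro exI[of _ "D a"]) (auto simp: D_def)
  qed
  moreover have "compact_space X"
    using compact_D[of 1] by (simp add: D_1 compact_space_def)
  moreover have "\<exists>B. (\<forall>K\<in>B. qc_open X K) \<and> U = \<Union>B" if U: "openin X U" for U
  proof -
    obtain S where "U = (\<Union>s\<in>S. D s)" using open_basis[OF U] by auto
    then show ?thesis
      using open_D compact_D by (intro exI[of _ "D ` S"]) (auto simp: qc_open_def)
  qed
  moreover have "qc_open X (K \<inter> L)" if K: "qc_open X K" and L: "qc_open X L" for K L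
  proof -
    obtain F where F: "finite F" "K = (\<Union>f\<in>F. D f)" using qc_finite[OF K] by auto
    obtain G where G: "finite G" "L = (\<Union>g\<in>G. D g)" using qc_finite[OF L] by auto
    have "K \<inter> L = (\<Union>p\<in>F \<times> G. D (fst p * snd p))" "finite (F \<times> G)"
      using F G by (auto simp: D_mult)
    then have "compactin X (K \<inter> L)" using compact_D by (auto intro: compactin_Union)
    then show ?thesis using K L by (auto simp: qc_open_def)
  qed
  moreover have "\<exists>x\<in>topspace X. X closure_of {x} = C" if C: "closedin X C" "irreducible_in X C" for C
  proof -
    \<comment> \<open>The zero ideal of the future generic point. Irreducibility of \<open>C\<close>
      gives primality; the other conditions pass to the intersection, where nonemptiness of
      \<open>C\<close> keeps 1 out.\<close>
    define P where "P = (\<Inter>x\<in>C. I x)"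
    have C': "C \<subseteq> topspace X" "C \<noteq> {}"
      and irr: "\<And>Y Z. closedin X Y \<Longrightarrow> closedin X Z \<Longrightarrow> C \<subseteq> Y \<union> Z \<Longrightarrow> C \<subseteq> Y \<or> C \<subseteq> Z"
      using C(2) by (auto simp: irreducible_in_def)
    have prime: "a \<in> P \<or> b \<in> P" if "a * b \<in> P" for a b
    proof -
      have "C \<subseteq> (topspace X - D a) \<union> (topspace X - D b)"
        using that C'(1) I(4) by (fastforce simp: P_def D_def)
      then have "C \<subseteq> topspace X - D a \<or> C \<subseteq> topspace X - D b"
        using irr open_D by blast
      then show ?thesis by (auto simp: P_def D_def)
    qed
    have "0 \<in> P" "1 \<notin> P" "a + b \<in> P \<longleftrightarrow> a \<in> P \<and> b \<in> P" "a \<in> P \<or> b \<in> P \<Longrightarrow> a * b \<in> P" for a b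
      using I C' by (auto simp: P_def subset_iff)
    with prime have "P \<in> Pr_s" unfolding Pr_s_iff by blast
    then obtain x where x: "x \<in> topspace X" "I x = P"
      using bij_betw_imp_surj_on[OF bij] by (metis imageE)
    obtain S where S: "C = {y \<in> topspace X. S \<subseteq> I y}" using closed[of C] C(1) by auto
    \<comment> \<open>Every \<open>I y\<close> with \<open>y\<close> in \<open>C\<close> contains
      \<open>S\<close>, hence so does their intersection \<open>P = I x\<close>.\<close>
    then have "x \<in> C" using x by (auto simp: P_def)
    then have "X closure_of {x} \<subseteq> C" using C(1) by (simp add: closure_of_minimal)
    \<comment> \<open>A set \<open>T\<close> cutting out the closure satisfies \<open>T\<close>
      \<subseteq> \<open>I x = P\<close>, and \<open>P\<close> \<subseteq> \<open>I y\<close> for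
      every \<open>y\<close> in \<open>C\<close>.\<close>
    moreover have "C \<subseteq> X closure_of {x}"
    proof -
      obtain T where T: "X closure_of {x} = {y \<in> topspace X. T \<subseteq> I y}"
        using closed closedin_closure_of by metis
      have "x \<in> X closure_of {x}" using closure_of_subset[of "{x}" X] x(1) by simp
      then have "T \<subseteq> P" using T x(2) by auto
      then show ?thesis using T C'(1) by (auto simp: P_def)
    qed
    ultimately show ?thesis using x(1) by blast
  qed
  ultimately show ?thesis unfolding spectral_space_def by blast
qed

section \<open>Maximal congruences and saturated primes\<close>

text \<open>There are only two classes, those of 0 and 1. A congruence containing this one and
  relating some \<open>x\<close> outside \<open>P\<close> to 0 would give 1 ~ \<open>x\<close> ~ 0
  and be trivial.\<close>

lemma two_class_congruence_in_MaxSpec: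
  assumes "P \<in> Pr_s"
  shows "two_class_congruence P \<in> MaxSpec"
proof -
  have P: "0 \<in> P" "1 \<notin> P" using assms by (auto simp: Pr_s_iff)
  have "congruence (two_class_congruence P)"
    using assms by (intro congruence_two_class_congruence) (auto simp: Pr_s_iff)
  moreover have "(1, 0) \<notin> two_class_congruence P" using P by (simp add: two_class_congruence_def)
  ultimately have "nontrivial_congruence (two_class_congruence P)"
    by (auto simp: nontrivial_congruence_def)
  moreover have "R = two_class_congruence P"
    if R: "nontrivial_congruence R" "two_class_congruence P \<subseteq> R" for R
  proof -
    have c: "congruence R" using R(1) by (simp add: nontrivial_congruence_def)
    have zero: "x \<in> P" if "(x, 0) \<in> R" for x
    proof (rule ccontr)
      assume "x \<notin> P"
      then have "(1, x) \<in> R" using P R(2) by (auto simp: two_class_congruence_def)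
      then have "1 \<in> zero_ideal R" using congruenceD(3)[OF c] that by (auto simp: zero_ideal_def)
      then show False using one_notin_zero_ideal[OF R(1)] by blast
    qed
    have "y \<in> P" if "(x, y) \<in> R" "x \<in> P" for x y
    proof -
      have "(x, 0) \<in> R" using P R(2) that(2) by (auto simp: two_class_congruence_def)
      then show ?thesis using zero congruenceD(2,3)[OF c] that(1) by blast
    qed
    then have "R \<subseteq> two_class_congruence P"
      using congruenceD(2)[OF c] by (auto simp: two_class_congruence_def)
    with R(2) show ?thesis by blast
  qed
  ultimately show ?thesis by (auto simp: MaxSpec_def)
qed

lemma zero_ideal_in_Pr_s:
  assumes "R \<in> Spec" shows "zero_ideal R \<in> Pr_s"
  using Spec_zero_ideal_in_Pr[OF assms] assms
  by (auto simp: Pr_s_def saturated_def Spec_def prime_congruence_def nontrivial_congruence_def)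

text \<open>Of two related elements, both or neither are related to 0, so any congruence is
  contained in the two-class congruence of its zero ideal. As the latter is nontrivial here,
  maximality of \<open>R\<close> forces equality.\<close>

lemma MaxSpec_eq_two_class_congruence:
  assumes "R \<in> MaxSpec" shows "R = two_class_congruence (zero_ideal R)"
proof -
  have c: "congruence R" using assms by (simp add: MaxSpec_def nontrivial_congruence_def)
  have "R \<subseteq> two_class_congruence (zero_ideal R)"
    using congruenceD(2,3)[OF c] unfolding two_class_congruence_def zero_ideal_def by blast
  moreover have "two_class_congruence (zero_ideal R) \<in> MaxSpec"
    using assms MaxSpec_subset_Spec zero_ideal_in_Pr_s two_class_congruence_in_MaxSpec by blast
  ultimately show ?thesis using assms by (auto simp: MaxSpec_def)
qed

lemma bij_betw_zero_ideal: "bij_betw zero_ideal MaxSpec Pr_s"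
proof (rule bij_betw_byWitness[where f' = two_class_congruence])
  show "\<forall>R\<in>MaxSpec. two_class_congruence (zero_ideal R) = R"
    using MaxSpec_eq_two_class_congruence by metis
  show "\<forall>P\<in>Pr_s. zero_ideal (two_class_congruence P) = P"
    by (simp add: Pr_s_iff zero_ideal_two_class_congruence)
  show "zero_ideal ` MaxSpec \<subseteq> Pr_s"
    using MaxSpec_subset_Spec zero_ideal_in_Pr_s by blast
  show "two_class_congruence ` Pr_s \<subseteq> MaxSpec"
    using two_class_congruence_in_MaxSpec by blast
qed

theorem corollary6p3:
  shows "spectral_space (Pr_s_topology :: 'a::b1_algebra set topology) \<and>
         spectral_space (MaxSpec_topology :: 'a::b1_algebra rel topology)"
proof
  \<comment> \<open>The trace of a closed set of \<open>Pr\<close> on \<open>Pr_s\<close> has the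
    form required by the criterion with \<open>I = id\<close>.\<close>
  have W: "W S \<inter> Pr_s = {P \<in> Pr_s. S \<subseteq> P}" for S :: "'a set"
    by (auto simp: W_def Pr_s_def)
  have "closedin Pr_s_topology C \<longleftrightarrow> (\<exists>S. C = {P \<in> Pr_s. S \<subseteq> P})" for C :: "'a set set"
    unfolding Pr_s_topology_def closedin_subtopology closedin_Pr_topology W[symmetric] by blast
  then show "spectral_space (Pr_s_topology :: 'a set topology)"
    using spectral_space_if_bij_betw_Pr_s[of id "Pr_s_topology :: 'a set topology"]
    by (simp add: topspace_Pr_s_topology bij_betw_id)
next
  \<comment> \<open>Likewise for traces on \<open>MaxSpec\<close>, now with
    \<open>I = zero_ideal\<close>; maximal congruences being prime removes the condition of lying in
    \<open>Spec\<close>.\<close>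
  have V: "V S \<inter> MaxSpec = {R \<in> MaxSpec. S \<subseteq> zero_ideal R}" for S :: "'a set"
    using MaxSpec_subset_Spec by (auto simp: V_def)
  have "closedin MaxSpec_topology C \<longleftrightarrow> (\<exists>S. C = {R \<in> MaxSpec. S \<subseteq> zero_ideal R})"
    for C :: "'a rel set"
    unfolding MaxSpec_topology_def closedin_subtopology closedin_Spec_topology V[symmetric] by blast
  then show "spectral_space (MaxSpec_topology :: 'a rel topology)"
    using spectral_space_if_bij_betw_Pr_s[of zero_ideal "MaxSpec_topology :: 'a rel topology"] bij_betw_zero_ideal
    by (simp add: topspace_MaxSpec_topology)
qed

end
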